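(* Let $m,n$ be positive integers, let $(R,f,g)$ be an $(m,n)$-seminearring and let $\rho$ be a congruence on $R$. Write $\rho(x)$ for the equivalence class of $x\in R$ and $R/\rho$ for the set of equivalence classes. Then $(R/\rho,f',g')$ is an $(m,n)$-seminearring together with the $m$-ary operation $f':(R/\rho)^m\to R/\rho$ defined by $$f'(\rho(x_1),\rho(x_2),\dots,\rho(x_m))=\rho(f(x_1,\dots,x_m))$$ and the $n$-ary operation $g':(R/\rho)^n\to R/\rho$ defined by $$g'(\rho(y_1),\rho(y_2),\dots,\rho(y_n))=\rho(g(y_1,\dots,y_n)).$$
   Context: An $m$-ary operation $f:R^m\to R$ on a nonempty set $R$ is associative if $f(a_1,\dots,a_{i-1},f(a_i,\dots,a_{m+i-1}),a_{m+i},\dots,a_{2m-1})=f(a_1,\dots,a_{j-1},f(a_j,\dots,a_{m+j-1}),a_{m+j},\dots,a_{2m-1})$ for all $a_1,\dots,a_{2m-1}\in R$ and $1\le i<j\le m$. An $(m,n)$-seminearring is a triple $(R,f,g)$ where $R$ is a nonempty set, $f:R^m\to R$ is an associative $m$-ary operation, $g:R^n\to R$ is an associative $n$-ary operation, and $g$ is $n$-distributive with respect to $f$, i.e. $g(b_1,\dots,b_{n-1},f(a_1,\dots,a_m))=f(g(b_1,\dots,b_{n-1},a_1),\dots,g(b_1,\dots,b_{n-1},a_m))$ for all $a_1,\dots,a_m,b_1,\dots,b_{n-1}\in R$. A congruence on $R$ is an equivalence relation $\rho$ on $R$ such that for all $a_i,b_i,c_j,d_j\in R$: (1) if $a_i\,\rho\,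 b_i$ for $1\le i\le m$, then $f(a_1,\dots,a_m)\,\rho\, f(b_1,\dots,b_m)$; (2) if $c_j\,\rho\, d_j$ for $1\le j\le n$, then $g(c_1,\dots,c_n)\,\rho\, g(d_1,\dots,d_n)$. *)

theory Defs
  imports "HOL-Library.NList" "HOL-Library.FuncSet"
begin

(* A k-tuple over R is an element of nlists k R, i.e. a list of length k with entries in R.  A k-ary
   operation on R is a function on lists that maps nlists k R into R; its values on all other lists
   are irrelevant. *)

definition nary_operation :: "nat \<Rightarrow> 'a set \<Rightarrow> ('a list \<Rightarrow> 'a) \<Rightarrow> bool" where
  "nary_operation k R h \<longleftrightarrow> h \<in> nlists k R \<rightarrow> R"

(* apply_at k h i [a_1, ..., a_(2k-1)] is the k-tuple
   [a_1, ..., a_(i-1), h [a_i, ..., a_(k+i-1)], a_(k+i), ..., a_(2k-1)], where 1 <= i <= k. *)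
definition apply_at :: "nat \<Rightarrow> ('a list \<Rightarrow> 'a) \<Rightarrow> nat \<Rightarrow> 'a list \<Rightarrow> 'a list" where
  "apply_at k h i as = take (i - 1) as @ [h (take k (drop (i - 1) as))] @ drop (k + i - 1) as"

definition nary_associative :: "nat \<Rightarrow> 'a set \<Rightarrow> ('a list \<Rightarrow> 'a) \<Rightarrow> bool" where
  "nary_associative k R h \<longleftrightarrow>
     (\<forall>as\<in>nlists (2 * k - 1) R. \<forall>i j. 1 \<le> i \<and> i < j \<and> j \<le> k \<longrightarrow>
        h (apply_at k h i as) = h (apply_at k h j as))"

(* Distributivity is required in the last argument of g only. *)
definition nary_distributive ::
    "nat \<Rightarrow> nat \<Rightarrow> 'a set \<Rightarrow> ('a list \<Rightarrow> 'a) \<Rightarrow> ('a list \<Rightarrow> 'a) \<Rightarrow> bool" where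
  "nary_distributive m n R f g \<longleftrightarrow>
     (\<forall>as\<in>nlists m R. \<forall>bs\<in>nlists (n - 1) R.
        g (bs @ [f as]) = f (map (\<lambda>a. g (bs @ [a])) as))"

(* Intended for m, n >= 1. *)
definition seminearring ::
    "nat \<Rightarrow> nat \<Rightarrow> 'a set \<Rightarrow> ('a list \<Rightarrow> 'a) \<Rightarrow> ('a list \<Rightarrow> 'a) \<Rightarrow> bool" where
  "seminearring m n R f g \<longleftrightarrow>
     R \<noteq> {} \<and>
     nary_operation m R f \<and> nary_associative m R f \<and>
     nary_operation n R g \<and> nary_associative n R g \<and>
     nary_distributive m n R f g"

definition compatible :: "nat \<Rightarrow> 'a set \<Rightarrow> ('a list \<Rightarrow> 'a) \<Rightarrow> ('a \<times> 'a) set \<Rightarrow> bool" where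
  "compatible k R h \<rho> \<longleftrightarrow>
     (\<forall>as\<in>nlists k R. \<forall>bs\<in>nlists k R.
        (\<forall>i<k. (as ! i, bs ! i) \<in> \<rho>) \<longrightarrow> (h as, h bs) \<in> \<rho>)"

definition congruence ::
    "nat \<Rightarrow> nat \<Rightarrow> 'a set \<Rightarrow> ('a list \<Rightarrow> 'a) \<Rightarrow> ('a list \<Rightarrow> 'a) \<Rightarrow> ('a \<times> 'a) set \<Rightarrow> bool" where
  "congruence m n R f g \<rho> \<longleftrightarrow> equiv R \<rho> \<and> compatible m R f \<rho> \<and> compatible n R g \<rho>"

(* h' is the operation on R // \<rho> with
   h' [\<rho>(x_1), ..., \<rho>(x_k)] = \<rho>(h [x_1, ..., x_k]).
   The extensional function space makes "exactly one such h'" meaningful, since it fixes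
   the values of h' on lists that are not k-tuples over R // \<rho>. *)
definition induced_operation ::
    "nat \<Rightarrow> 'a set \<Rightarrow> ('a \<times> 'a) set \<Rightarrow> ('a list \<Rightarrow> 'a) \<Rightarrow> ('a set list \<Rightarrow> 'a set) \<Rightarrow> bool" where
  "induced_operation k R \<rho> h h' \<longleftrightarrow>
     h' \<in> nlists k (R // \<rho>) \<rightarrow>\<^sub>E R // \<rho> \<and>
     (\<forall>xs\<in>nlists k R. h' (map (\<lambda>x. \<rho> `` {x}) xs) = \<rho> `` {h xs})"

end

theory Submission
  imports Defs
begin

text \<open>
  Every tuple of classes is the image of a tuple of representatives under the projection
  \<open>x \<mapsto> \<rho>(x)\<close>, and the induced operations are exactly those that make the projection a
  homomorphism. So each law on the quotient is the image of the same law on \<open>R\<close>.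
\<close>

text \<open>As simplification rules, these two loop together with the definition of \<^const>\<open>nlists\<close>.\<close>
declare nlistsE_length [simp del] nlistsE_set [simp del]

text \<open>The quotient is the image of \<open>R\<close> under the projection, and
  \<open>lists\<close> commutes with images, so representatives of all entries come at once;
  \<open>map\<close> keeps the length.\<close>

lemma nlists_quotientE:
  assumes "Xs \<in> nlists k (R // \<rho>)"
  obtains xs where "xs \<in> nlists k R" "Xs = map (\<lambda>x. \<rho> `` {x}) xs"
proof -
  have "Xs \<in> lists ((\<lambda>x. \<rho> `` {x}) ` R)"
    using assms by (auto simp: nlists_def quotient_def)
  then obtain xs where "xs \<in> lists R" "Xs = map (\<lambda>x. \<rho> `` {x}) xs"
    unfolding lists_image by blast
  with assms show thesis
    by (intro that[of xs]) (auto simp: nlists_def)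
qed

lemma map_class_in_nlists_quotient:
  "xs \<in> nlists k R \<Longrightarrow> map (\<lambda>x. \<rho> `` {x}) xs \<in> nlists k (R // \<rho>)"
  by (auto simp: nlists_def intro: quotientI)

text \<open>Independence of representatives: entries with equal classes are related, and
  compatibility passes this on to the values of \<open>h\<close>.\<close>

lemma compatible_map_class_eq:
  assumes "equiv R \<rho>" "compatible k R h \<rho>" "xs \<in> nlists k R" "ys \<in> nlists k R"
    and eq: "map (\<lambda>x. \<rho> `` {x}) xs = map (\<lambda>x. \<rho> `` {x}) ys"
  shows "\<rho> `` {h xs} = \<rho> `` {h ys}"
proof -
  have "(xs ! i, ys ! i) \<in> \<rho>" if "i < k" for i
  proof -
    have "\<rho> `` {xs ! i} = \<rho> `` {ys ! i}"
      using arg_cong[OF eq, of "\<lambda>zs. zs ! i"] that assms(3,4) by (simp add: nlists_def)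
    \<comment> \<open>Equality of classes yields related elements only inside \<open>R\<close>:
      elements outside \<open>R\<close> all have the empty class.\<close>
    moreover have "ys ! i \<in> R"
      using that assms(4) by (auto simp: nlists_def)
    ultimately show ?thesis
      using assms(1) by (blast intro: eq_equiv_class)
  qed
  then have "(h xs, h ys) \<in> \<rho>"
    using assms(2-4) by (auto simp: compatible_def)
  then show ?thesis
    by (rule equiv_class_eq[OF assms(1)])
qed

lemma ex1_induced_operation:
  assumes "equiv R \<rho>" "compatible k R h \<rho>" "nary_operation k R h"
  shows "\<exists>!h'. induced_operation k R \<rho> h h'"
proof (rule ex_ex1I)
  let ?c = "\<lambda>x. \<rho> `` {x}"
  define rep where "rep Xs = (SOME xs. xs \<in> nlists k R \<and> Xs = map ?c xs)" for Xs
  have rep: "rep Xs \<in> nlists k R \<and> Xs = map ?c (rep Xs)" if "Xs \<in> nlists k (R // \<rho>)" for Xs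
    unfolding rep_def by (rule someI_ex) (use that in \<open>blast elim: nlists_quotientE\<close>)
  define h' where "h' = (\<lambda>Xs\<in>nlists k (R // \<rho>). ?c (h (rep Xs)))"
  have "induced_operation k R \<rho> h h'"
    unfolding induced_operation_def h'_def
  proof (intro conjI ballI)
    show "(\<lambda>Xs\<in>nlists k (R // \<rho>). ?c (h (rep Xs))) \<in> nlists k (R // \<rho>) \<rightarrow>\<^sub>E R // \<rho>"
      using rep assms(3) by (auto simp: nary_operation_def intro!: quotientI)
  next
    fix xs assume xs: "xs \<in> nlists k R"
    then have Xs: "map ?c xs \<in> nlists k (R // \<rho>)"
      by (rule map_class_in_nlists_quotient)
    \<comment> \<open>The chosen tuple \<open>rep (map ?c xs)\<close> may differ from
      \<open>xs\<close>, but it has the same classes entry by entry.\<close>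
    have "?c (h (rep (map ?c xs))) = ?c (h xs)"
      using assms(1,2) rep[OF Xs] xs by (intro compatible_map_class_eq) auto
    with Xs show "(\<lambda>Xs\<in>nlists k (R // \<rho>). ?c (h (rep Xs))) (map ?c xs) = ?c (h xs)"
      by simp
  qed
  then show "\<exists>h'. induced_operation k R \<rho> h h'" by blast
next
  fix h1 h2
  assume h: "induced_operation k R \<rho> h h1" "induced_operation k R \<rho> h h2"
  show "h1 = h2"
  \<comment> \<open>Both functions are \<open>undefined\<close> off the tuples of classes, so it
    suffices to compare them on tuples, each of which has representatives.\<close>
  proof (rule PiE_ext)
    show "h1 \<in> nlists k (R // \<rho>) \<rightarrow>\<^sub>E R // \<rho>" "h2 \<in> nlists k (R // \<rho>) \<rightarrow>\<^sub>E R // \<rho>"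
      using h by (auto simp: induced_operation_def)
  next
    fix Xs assume "Xs \<in> nlists k (R // \<rho>)"
    then obtain xs where "xs \<in> nlists k R" "Xs = map (\<lambda>x. \<rho> `` {x}) xs"
      by (rule nlists_quotientE)
    with h show "h1 Xs = h2 Xs"
      by (simp add: induced_operation_def)
  qed
qed

lemma induced_operation_class:
  "induced_operation k R \<rho> h h' \<Longrightarrow> xs \<in> nlists k R \<Longrightarrow>
    h' (map (\<lambda>x. \<rho> `` {x}) xs) = \<rho> `` {h xs}"
  by (simp add: induced_operation_def)

lemma nary_operation_induced:
  "induced_operation k R \<rho> h h' \<Longrightarrow> nary_operation k (R // \<rho>) h'"
  by (auto simp: induced_operation_def nary_operation_def)

text \<open>For \<open>i \<le> k\<close> the block ends at position
  \<open>k + i - 1 \<le> 2 * k - 1\<close>, so \<open>take\<close> is not cut short.\<close>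

lemma take_drop_in_nlists:
  assumes "as \<in> nlists (2 * k - 1) R" "1 \<le> i" "i \<le> k"
  shows "take k (drop (i - 1) as) \<in> nlists k R"
proof -
  have "set (take k (drop (i - 1) as)) \<subseteq> R"
    using assms(1) by (auto simp: nlists_def dest!: in_set_takeD in_set_dropD)
  with assms show ?thesis
    by (auto simp: nlists_def)
qed

text \<open>The three pieces have lengths \<open>i - 1\<close>, \<open>1\<close> and
  \<open>k - i\<close>, which add up to \<open>k\<close>.\<close>

lemma apply_at_in_nlists:
  assumes "nary_operation k R h" "as \<in> nlists (2 * k - 1) R" "1 \<le> i" "i \<le> k"
  shows "apply_at k h i as \<in> nlists k R"
proof -
  have "h (take k (drop (i - 1) as)) \<in> R"
    using assms take_drop_in_nlists[of as k R i] by (auto simp: nary_operation_def)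
  moreover have "set (take (i - 1) as) \<subseteq> R" "set (drop (k + i - 1) as) \<subseteq> R"
    using assms(2) by (auto simp: nlists_def dest!: in_set_takeD in_set_dropD)
  ultimately show ?thesis
    using assms by (auto simp: nlists_def apply_at_def)
qed

text \<open>\<open>map\<close> commutes with \<open>take\<close> and \<open>drop\<close>, so only
  the middle entry matters, and there the defining equation of \<open>h'\<close> applies.\<close>

lemma apply_at_map_class:
  assumes "induced_operation k R \<rho> h h'" "as \<in> nlists (2 * k - 1) R" "1 \<le> i" "i \<le> k"
  shows "apply_at k h' i (map (\<lambda>x. \<rho> `` {x}) as) = map (\<lambda>x. \<rho> `` {x}) (apply_at k h i as)"
  using assms take_drop_in_nlists[of as k R i]
  by (simp add: induced_operation_def apply_at_def take_map drop_map)

lemma nary_associative_induced: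
  assumes "nary_operation k R h" "nary_associative k R h" "induced_operation k R \<rho> h h'"
  shows "nary_associative k (R // \<rho>) h'"
  unfolding nary_associative_def
proof (intro ballI allI impI)
  fix As i j
  assume "As \<in> nlists (2 * k - 1) (R // \<rho>)" and ij: "1 \<le> i \<and> i < j \<and> j \<le> k"
  then obtain as where as: "as \<in> nlists (2 * k - 1) R" and As: "As = map (\<lambda>x. \<rho> `` {x}) as"
    by (blast elim: nlists_quotientE)
  \<comment> \<open>The defining equation of \<open>h'\<close> is used twice: for the inner
    application, then for the outer one.\<close>
  have *: "h' (apply_at k h' l As) = \<rho> `` {h (apply_at k h l as)}" if "1 \<le> l" "l \<le> k" for l
    using apply_at_map_class[OF assms(3) as that] apply_at_in_nlists[OF assms(1) as that] assms(3)
    by (simp add: As induced_operation_def)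
  have "h (apply_at k h i as) = h (apply_at k h j as)"
    using assms(2) as ij by (auto simp: nary_associative_def)
  with * ij show "h' (apply_at k h' i As) = h' (apply_at k h' j As)"
    by simp
qed

lemma nary_distributive_induced:
  assumes "n \<ge> 1" "nary_operation m R f" "nary_operation n R g" "nary_distributive m n R f g"
    and f': "induced_operation m R \<rho> f f'" and g': "induced_operation n R \<rho> g g'"
  shows "nary_distributive m n (R // \<rho>) f' g'"
  unfolding nary_distributive_def
proof (intro ballI)
  let ?c = "\<lambda>x. \<rho> `` {x}"
  fix As Bs
  assume "As \<in> nlists m (R // \<rho>)" "Bs \<in> nlists (n - 1) (R // \<rho>)"
  then obtain as bs where as: "as \<in> nlists m R" "As = map ?c as"
    and bs: "bs \<in> nlists (n - 1) R" "Bs = map ?c bs"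
    by (elim nlists_quotientE) blast
  \<comment> \<open>Subtraction on \<open>nat\<close> truncates at 0, so \<open>n \<ge> 1\<close> is
    what gives \<open>bs @ [a]\<close> length \<open>n\<close>.\<close>
  have mem: "bs @ [a] \<in> nlists n R" if "a \<in> R" for a
    using bs(1) that \<open>n \<ge> 1\<close> by (auto simp: nlists_def)
  have g'_class: "g' (Bs @ [?c a]) = ?c (g (bs @ [a]))" if "a \<in> R" for a
    using induced_operation_class[OF g' mem[OF that]] by (simp add: bs(2))
  have asR: "set as \<subseteq> R"
    using as(1) by (rule nlistsE_set)
  have "f as \<in> R"
    using assms(2) as(1) by (auto simp: nary_operation_def)
  have images: "map (\<lambda>a. g (bs @ [a])) as \<in> nlists m R"
  proof -
    have "g (bs @ [a]) \<in> R" if "a \<in> R" for a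
      using funcset_mem[OF assms(3)[unfolded nary_operation_def] mem[OF that]] .
    then show ?thesis
      using as(1) by (auto simp: nlists_def)
  qed
  \<comment> \<open>The left side is pulled back to \<open>R\<close>, distributivity is applied
    there, and the result is projected again.\<close>
  have "g' (Bs @ [f' As]) = ?c (g (bs @ [f as]))"
    using f' as g'_class[OF \<open>f as \<in> R\<close>] by (simp add: induced_operation_def)
  also have "\<dots> = ?c (f (map (\<lambda>a. g (bs @ [a])) as))"
    using assms(4) as(1) bs(1) by (simp add: nary_distributive_def)
  also have "\<dots> = f' (map ?c (map (\<lambda>a. g (bs @ [a])) as))"
    by (rule induced_operation_class[OF f' images, symmetric])
  also have "map ?c (map (\<lambda>a. g (bs @ [a])) as) = map (\<lambda>A. g' (Bs @ [A])) As"
    using g'_class asR by (auto simp: as(2))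
  finally show "g' (Bs @ [f' As]) = f' (map (\<lambda>A. g' (Bs @ [A])) As)" .
qed

theorem theorem3p25:
  fixes m n :: nat and R :: "'a set" and f g :: "'a list \<Rightarrow> 'a" and \<rho> :: "('a \<times> 'a) set"
  assumes "m \<ge> 1" and "n \<ge> 1"
    and "seminearring m n R f g"
    and "congruence m n R f g \<rho>"
  shows "(\<exists>!f'. induced_operation m R \<rho> f f') \<and>
         (\<exists>!g'. induced_operation n R \<rho> g g') \<and>
         (\<forall>f' g'. induced_operation m R \<rho> f f' \<and> induced_operation n R \<rho> g g' \<longrightarrow>
            seminearring m n (R // \<rho>) f' g')"
proof -
  have R: "R \<noteq> {}" and f: "nary_operation m R f" "nary_associative m R f"
    and g: "nary_operation n R g" "nary_associative n R g" and d: "nary_distributive m n R f g"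
    using assms(3) by (auto simp: seminearring_def)
  have "equiv R \<rho>" "compatible m R f \<rho>" "compatible n R g \<rho>"
    using assms(4) by (auto simp: congruence_def)
  \<comment> \<open>Each law is inherited from \<open>R\<close> through the defining equations
    alone, so \<open>f'\<close> and \<open>g'\<close> can stay arbitrary.\<close>
  moreover have "seminearring m n (R // \<rho>) f' g'"
    if "induced_operation m R \<rho> f f'" "induced_operation n R \<rho> g g'" for f' g'
    using that R f g nary_distributive_induced[OF assms(2) f(1) g(1) d that]
    by (simp add: seminearring_def nary_operation_induced nary_associative_induced)
  ultimately show ?thesis
    using f(1) g(1) by (simp add: ex1_induced_operation)
qed

end
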